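(* In the transport model (defined in the context), let $\psi$ be a relative phase between the down and up $(2,3)$ blocks, all other phases being confined to the $(1,2)$ blocks, with relative phase $\varphi$ there. Then the following values are obtained: $$\begin{array}{lcccc}\psi & 0^\circ & 30^\circ & 45^\circ & 90^\circ\\ |V_{cb}| & 0.0422 & 0.0665 & 0.0870 & 0.1467\\ |V_{ub}| & 0.0018 & 0.0028 & 0.0037 & 0.0062\end{array}$$ and the pattern is exact: the elements $V_{ub}$ and $V_{cb}$ share the common factor $$D(\psi)=s^d_{23}c^u_{23}-e^{i\psi}c^d_{23}s^u_{23},$$ namely $$V_{ub}=-s^u_{12}e^{-i\varphi}D(\psi),\qquad V_{cb}=c^u_{12}D(\psi),$$ so the ratio $|V_{ub}/V_{cb}|=\tan\theta^u_{12}$ holds for every $\psi$, while $|D(\psi)|$ is strictly increasing on $[0,\pi]$. Hence no $\psi$ can repair $|V_{ub}|$ (that is, raise its $\psi=0$ value $0.0018$ to the measured $0.003762$) without inflating $|V_{cb}|$ by the same factor (its $\psi=0$ value being $0.0422$, the measured one $0.04188$): the $(2,3)$ interference must remain destructive and real, and the $|V_{ub}|$ deficit must be repaired elsewhere.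
   Context: Transport model: for each quark sector $f\in\{u,d\}$ (up, down) the left frame is the ordered product $U_f=R_{23}(\theta^f_{23})R_{12}(\theta^f_{12})$ of two-state rotations in the $(2,3)$ and $(1,2)$ generation planes, whose off-diagonal entries may carry phases, and the CKM matrix is $V=U_u^\dagger U_d$, with rows labelled $u,c,t$ and columns $d,s,b$. The angles lie in $(0,\pi/2)$ and, with $\delta=\sqrt{3/8}$, are given by $\tan\theta^u_{12}=\frac{2/3-\delta}{2/3+\delta}$, $\tan\theta^u_{23}=\frac{2/3-\delta}{2/3}$, $\tan\theta^d_{12}=\frac{1-\delta}{1+\delta}$, and $\sin\theta^d_{23}=\sin\theta_2\sin\theta_3$ with $\tan\theta_2=\frac{1}{1+\delta}$, $\tan\theta_3=\frac{1-\delta}{1+\delta}$. Here $s^f_{ij}=\sin\theta^f_{ij}$ and $c^f_{ij}=\cos\theta^f_{ij}$. The sign and phase conventions of the rotations are those in which the displayed formulas for $V_{ub}$ and $V_{cb}$ hold. The measured values are central values of the 2026 Particle Data Group global fit. "Destructive and real" refers to the two terms of $D$, which subtract without a relative phase at $\psi=0$. *)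

theory Defs
  imports "HOL-Analysis.Analysis"
begin

definition hermitian_conj :: "complex^'n^'m \<Rightarrow> complex^'m^'n" where
  "hermitian_conj A = (\<chi> i j. cnj (A $ j $ i))"

text \<open>
  Two-state rotations whose off-diagonal entries carry a phase. The signs are fixed by requiring
  the closed forms \<open>V_ub = - s e^(-i \<phi>) D(\<psi>)\<close>, \<open>V_cb = c D(\<psi>)\<close> to hold on the nose, with \<open>\<psi>\<close> the
  down-minus-up phase in the (2,3) plane and \<open>\<phi>\<close> the up-minus-down phase in the (1,2) plane.
\<close>

definition rot12 :: "real \<Rightarrow> real \<Rightarrow> complex^3^3" where
  "rot12 \<theta> \<beta> = vector
     [vector [of_real (cos \<theta>), of_real (sin \<theta>) * cis (-\<beta>), 0],
      vector [- of_real (sin \<theta>) * cis \<beta>, of_real (cos \<theta>), 0],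
      vector [0, 0, 1]]"

definition rot23 :: "real \<Rightarrow> real \<Rightarrow> complex^3^3" where
  "rot23 \<theta> \<alpha> = vector
     [vector [1, 0, 0],
      vector [0, of_real (cos \<theta>), of_real (sin \<theta>) * cis (-\<alpha>)],
      vector [0, - of_real (sin \<theta>) * cis \<alpha>, of_real (cos \<theta>)]]"

definition left_frame :: "real \<Rightarrow> real \<Rightarrow> real \<Rightarrow> real \<Rightarrow> complex^3^3" where
  "left_frame \<theta>23 \<alpha> \<theta>12 \<beta> = rot23 \<theta>23 \<alpha> ** rot12 \<theta>12 \<beta>"

definition \<delta> :: real where "\<delta> = sqrt (3/8)"

definition \<theta>u12 :: real where "\<theta>u12 = arctan ((2/3 - \<delta>) / (2/3 + \<delta>))"
definition \<theta>u23 :: real where "\<theta>u23 = arctan ((2/3 - \<delta>) / (2/3))"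
definition \<theta>d12 :: real where "\<theta>d12 = arctan ((1 - \<delta>) / (1 + \<delta>))"
definition \<theta>2 :: real where "\<theta>2 = arctan (1 / (1 + \<delta>))"
definition \<theta>3 :: real where "\<theta>3 = arctan ((1 - \<delta>) / (1 + \<delta>))"
definition \<theta>d23 :: real where "\<theta>d23 = arcsin (sin \<theta>2 * sin \<theta>3)"

lemma \<delta>_bounds: "0 < \<delta>" "\<delta> < 2/3"
proof -
  show "0 < \<delta>" by (simp add: \<delta>_def)
  show "\<delta> < 2/3" unfolding \<delta>_def by (rule real_less_lsqrt) (auto simp: power2_eq_square)
qed

lemma arctan_first_quadrant: "0 < x \<Longrightarrow> arctan x \<in> {0<..<pi/2}"
  using arctan_ubound[of x] by simp

lemma angles_first_quadrant:
  "\<theta>u12 \<in> {0<..<pi/2}" "\<theta>u23 \<in> {0<..<pi/2}" "\<theta>d12 \<in> {0<..<pi/2}"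
  "\<theta>2 \<in> {0<..<pi/2}" "\<theta>3 \<in> {0<..<pi/2}" "\<theta>d23 \<in> {0<..<pi/2}"
proof -
  show "\<theta>u12 \<in> {0<..<pi/2}" "\<theta>u23 \<in> {0<..<pi/2}" "\<theta>d12 \<in> {0<..<pi/2}"
    unfolding \<theta>u12_def \<theta>u23_def \<theta>d12_def using \<delta>_bounds
    by (intro arctan_first_quadrant; simp)+
  show 2: "\<theta>2 \<in> {0<..<pi/2}" and 3: "\<theta>3 \<in> {0<..<pi/2}"
    unfolding \<theta>2_def \<theta>3_def using \<delta>_bounds by (intro arctan_first_quadrant; simp)+
  have pos: "0 < sin \<theta>2" "0 < sin \<theta>3" using 2 3 by (auto intro!: sin_gt_zero2)
  have lt: "sin \<theta>2 < 1" "sin \<theta>3 < 1"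
    using 2 3 sin_monotone_2pi[of \<theta>2 "pi/2"] sin_monotone_2pi[of \<theta>3 "pi/2"] by auto
  have "sin \<theta>2 * sin \<theta>3 < 1 * 1"
    using pos lt by (intro mult_strict_mono) auto
  moreover have "0 < sin \<theta>2 * sin \<theta>3" using pos by simp
  ultimately show "\<theta>d23 \<in> {0<..<pi/2}"
    using arcsin_less_arcsin[of 0 "sin \<theta>2 * sin \<theta>3"] arcsin_less_arcsin[of "sin \<theta>2 * sin \<theta>3" 1]
    by (simp add: \<theta>d23_def)
qed

lemma sin_\<theta>d23: "sin \<theta>d23 = sin \<theta>2 * sin \<theta>3"
proof -
  have "\<bar>sin \<theta>2 * sin \<theta>3\<bar> \<le> 1 * 1" unfolding abs_mult by (intro mult_mono) auto
  then show ?thesis unfolding \<theta>d23_def by (intro sin_arcsin) auto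
qed

text \<open>Rows and columns 1, 2, 3 are \<open>u, c, t\<close> and \<open>d, s, b\<close>.\<close>

definition ckm_phases :: "real \<Rightarrow> real \<Rightarrow> real \<Rightarrow> real \<Rightarrow> complex^3^3" where
  "ckm_phases \<alpha>u \<beta>u \<alpha>d \<beta>d =
     hermitian_conj (left_frame \<theta>u23 \<alpha>u \<theta>u12 \<beta>u) ** left_frame \<theta>d23 \<alpha>d \<theta>d12 \<beta>d"

text \<open>
  Only the relative phases matter: a rephasing of the generation basis common to both sectors
  makes the down frame real (see the lemma below), and the closed forms refer to this choice.
\<close>

definition ckm :: "real \<Rightarrow> real \<Rightarrow> complex^3^3" where
  "ckm \<psi> \<phi> = ckm_phases (-\<psi>) \<phi> 0 0"

lemma ckm_phases_rephase:
  fixes \<alpha>u \<beta>u \<alpha>d \<beta>d :: real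
  defines "k \<equiv> (vector [cis (-\<beta>d), 1, cis \<alpha>d] :: complex^3)"
  shows "ckm_phases \<alpha>u \<beta>u \<alpha>d \<beta>d $ i $ j =
         k $ i * ckm (\<alpha>d - \<alpha>u) (\<beta>u - \<beta>d) $ i $ j * cnj (k $ j)"
proof -
  have c: "cis (a - b) = cis a / cis b" "cis (- a) = 1 / cis a" for a b
    by (simp_all add: cis_divide flip: cis_inverse inverse_eq_divide)
  show ?thesis
    using exhaust_3[of i] exhaust_3[of j]
    by (auto simp: ckm_def ckm_phases_def hermitian_conj_def left_frame_def rot12_def rot23_def
        matrix_matrix_mult_def sum_3 k_def cis_cnj c field_simps)
qed

definition V_ub :: "real \<Rightarrow> real \<Rightarrow> complex" where "V_ub \<psi> \<phi> = ckm \<psi> \<phi> $ 1 $ 3"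
definition V_cb :: "real \<Rightarrow> real \<Rightarrow> complex" where "V_cb \<psi> \<phi> = ckm \<psi> \<phi> $ 2 $ 3"

definition D :: "real \<Rightarrow> complex" where
  "D \<psi> = of_real (sin \<theta>d23 * cos \<theta>u23) - cis \<psi> * of_real (cos \<theta>d23 * sin \<theta>u23)"

definition rounds4 :: "real \<Rightarrow> real \<Rightarrow> bool" where
  "rounds4 x v \<longleftrightarrow> \<bar>x - v\<bar> < 1 / (2 * 10^4)"

text \<open>Central values of the 2026 Particle Data Group global fit (absolute values of the elements).\<close>

definition V_ub_meas :: real where "V_ub_meas = 0.003762"
definition V_cb_meas :: real where "V_cb_meas = 0.04188"

end

theory Submission imports Defs begin

text \<open>
  With \<open>A = s\<^sup>d\<^sub>2\<^sub>3 c\<^sup>u\<^sub>2\<^sub>3\<close> and \<open>B = c\<^sup>d\<^sub>2\<^sub>3 s\<^sup>u\<^sub>2\<^sub>3\<close> one has \<open>|D(\<psi>)|\<^sup>2 = (A - B)\<^sup>2 + 2 A B (1 - cos \<psi>)\<close>,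
  so \<open>|D|\<close> depends on \<open>\<psi>\<close> through \<open>cos \<psi>\<close> alone and is least exactly where \<open>cos \<psi> = 1\<close>. For the
  numbers, \<open>\<delta>\<^sup>2 = 3/8\<close> turns the squares of all sines and cosines involved into quotients of
  linear polynomials in \<open>\<delta>\<close>, so that rational bounds on \<open>\<delta>\<close> give rational bounds on them.
\<close>

section \<open>Squares of sine and cosine, and interval tools\<close>

lemma sin_squared_arctan_divide:
  assumes "0 < y"
  shows "(sin (arctan (x / y)))\<^sup>2 = x\<^sup>2 / (x\<^sup>2 + y\<^sup>2)"
proof -
  have "(sin (arctan (x / y)))\<^sup>2 = (x / y)\<^sup>2 / (1 + (x / y)\<^sup>2)"
    unfolding sin_arctan power_divide[of "x / y" "sqrt _"] by (subst real_sqrt_pow2) simp_all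
  also have "\<dots> = x\<^sup>2 / (x\<^sup>2 + y\<^sup>2)"
    using assms by (simp add: power_divide add_divide_eq_iff add.commute)
  finally show ?thesis .
qed

lemma cos_squared_arctan_divide:
  assumes "0 < y"
  shows "(cos (arctan (x / y)))\<^sup>2 = y\<^sup>2 / (x\<^sup>2 + y\<^sup>2)"
proof -
  have "0 < x\<^sup>2 + y\<^sup>2" using assms by (simp add: add_nonneg_pos)
  then show ?thesis
    using assms by (simp add: cos_squared_eq sin_squared_arctan_divide field_simps)
qed

text \<open>The sines, cosines and moduli below are nonnegative and known exactly only through their
  squares; this carries rational enclosures back from the squares.\<close>

lemma square_bounds:
  fixes x :: real
  assumes "0 \<le> x" "0 \<le> u" "l\<^sup>2 \<le> x\<^sup>2" "x\<^sup>2 \<le> u\<^sup>2"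
  shows "l \<le> x" "x \<le> u"
  using assms power2_le_imp_le by blast+

lemma mult_bounds:
  fixes x y :: real
  assumes "a \<le> x" "x \<le> b" "c \<le> y" "y \<le> d" "0 \<le> a" "0 \<le> c"
  shows "a * c \<le> x * y" "x * y \<le> b * d"
  using assms by (auto intro: mult_mono)

section \<open>Exact squares in terms of \<delta>\<close>

lemma \<delta>_squared: "\<delta>\<^sup>2 = 3/8"
  by (simp add: \<delta>_def)

text \<open>The many digits offset cancellation: \<open>sin_squared_\<theta>u12\<close> is a
  difference of nearly equal numbers, about 0.5 - 0.4982.\<close>

lemma \<delta>_interval: "0.612372435 \<le> \<delta>" "\<delta> \<le> 0.612372436"
  unfolding \<delta>_def
  by (rule real_le_rsqrt real_le_lsqrt; simp add: power2_eq_square)+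

lemma sin_cos_positive:
  "0 < sin \<theta>u12" "0 < cos \<theta>u12" "0 < sin \<theta>u23" "0 < cos \<theta>u23" "0 < sin \<theta>d23" "0 < cos \<theta>d23"
  using angles_first_quadrant by (auto intro!: sin_gt_zero2 cos_gt_zero)

text \<open>Here 19/8 + 2 \<delta> is 1 + (1 + \<delta>)^2, and 11/4 is (1 - \<delta>)^2 + (1 +
  \<delta>)^2, where the linear terms cancel.\<close>

lemma sin_squared_\<theta>d23: "(sin \<theta>d23)\<^sup>2 = (11/8 - 2 * \<delta>) / (11/4 * (19/8 + 2 * \<delta>))"
proof -
  have pos: "0 < 1 + \<delta>" using \<delta>_bounds by simp
  have "(1 + \<delta>)\<^sup>2 = 11/8 + 2 * \<delta>" "(1 - \<delta>)\<^sup>2 = 11/8 - 2 * \<delta>"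
    by (simp_all add: power2_sum power2_diff \<delta>_squared)
  then have "(sin \<theta>2)\<^sup>2 = 1 / (19/8 + 2 * \<delta>)" "(sin \<theta>3)\<^sup>2 = (11/8 - 2 * \<delta>) / (11/4)"
    unfolding \<theta>2_def \<theta>3_def sin_squared_arctan_divide[OF pos] by simp_all
  then show ?thesis
    by (simp only: sin_\<theta>d23 power_mult_distrib times_divide_times_eq mult_1 mult.commute)
qed

lemma cos_squared_\<theta>u23: "(cos \<theta>u23)\<^sup>2 = 1 / (91/32 - 3 * \<delta>)"
proof -
  \<comment> \<open>The factor is 1 + (1 - 3 \<delta>/2)^2, the squared secant of
    \<open>\<theta>u23\<close>.\<close>
  have "(2/3 - \<delta>)\<^sup>2 + (2/3)\<^sup>2 = (91/32 - 3 * \<delta>) * (2/3)\<^sup>2"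
    by (simp add: power2_diff \<delta>_squared) (simp add: power2_eq_square)
  then have "(cos \<theta>u23)\<^sup>2 = (2/3)\<^sup>2 / ((91/32 - 3 * \<delta>) * (2/3)\<^sup>2)"
    by (simp only: \<theta>u23_def cos_squared_arctan_divide[of "2/3"] zero_less_divide_iff zero_less_numeral simp_thms)
  then show ?thesis by simp
qed

text \<open>The denominator (2/3 - \<delta>)^2 + (2/3 + \<delta>)^2 is the constant 59/36, so the
  square is linear in \<delta>.\<close>

lemma cos_squared_\<theta>u12: "(cos \<theta>u12)\<^sup>2 = 1/2 + 48/59 * \<delta>"
proof -
  have pos: "0 < 2/3 + \<delta>" using \<delta>_bounds by simp
  have e: "(2/3 + \<delta>)\<^sup>2 = 59/72 + 4/3 * \<delta>" "(2/3 - \<delta>)\<^sup>2 = 59/72 - 4/3 * \<delta>"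
    by (simp_all add: power2_sum power2_diff \<delta>_squared) (simp_all add: power2_eq_square)
  show ?thesis
    unfolding \<theta>u12_def cos_squared_arctan_divide[OF pos] e by simp
qed

lemma sin_squared_\<theta>u12: "(sin \<theta>u12)\<^sup>2 = 1/2 - 48/59 * \<delta>"
  using sin_cos_squared_add[of \<theta>u12] by (simp add: cos_squared_\<theta>u12)

section \<open>Rational enclosures of the sines and cosines\<close>

lemma sin_\<theta>d23_interval: "0.1232003 \<le> sin \<theta>d23" "sin \<theta>d23 \<le> 0.1232006"
proof -
  have "0.1232003\<^sup>2 \<le> (sin \<theta>d23)\<^sup>2" "(sin \<theta>d23)\<^sup>2 \<le> 0.1232006\<^sup>2"
    \<comment> \<open>Clearing the positive denominator leaves inequalities linear in \<delta>. The
      five enclosures that follow reduce to linear inequalities likewise.\<close>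
    unfolding sin_squared_\<theta>d23 using \<delta>_interval by (simp_all add: field_simps power2_eq_square)
  then show "0.1232003 \<le> sin \<theta>d23" "sin \<theta>d23 \<le> 0.1232006"
    using square_bounds[of "sin \<theta>d23" "0.1232006" "0.1232003"] sin_cos_positive by simp_all
qed

lemma cos_\<theta>d23_interval: "0.9923817 \<le> cos \<theta>d23" "cos \<theta>d23 \<le> 0.9923820"
proof -
  have "0.9923817\<^sup>2 \<le> (cos \<theta>d23)\<^sup>2" "(cos \<theta>d23)\<^sup>2 \<le> 0.9923820\<^sup>2"
    unfolding cos_squared_eq sin_squared_\<theta>d23
    using \<delta>_interval by (simp_all add: field_simps power2_eq_square)
  then show "0.9923817 \<le> cos \<theta>d23" "cos \<theta>d23 \<le> 0.9923820"
    using square_bounds[of "cos \<theta>d23" "0.9923820" "0.9923817"] sin_cos_positive by simp_all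
qed

lemma cos_\<theta>u23_interval: "0.9966999 \<le> cos \<theta>u23" "cos \<theta>u23 \<le> 0.9967002"
proof -
  have "0.9966999\<^sup>2 \<le> (cos \<theta>u23)\<^sup>2" "(cos \<theta>u23)\<^sup>2 \<le> 0.9967002\<^sup>2"
    unfolding cos_squared_\<theta>u23 using \<delta>_interval by (simp_all add: field_simps power2_eq_square)
  then show "0.9966999 \<le> cos \<theta>u23" "cos \<theta>u23 \<le> 0.9967002"
    using square_bounds[of "cos \<theta>u23" "0.9967002" "0.9966999"] sin_cos_positive by simp_all
qed

lemma sin_\<theta>u23_interval: "0.0811724 \<le> sin \<theta>u23" "sin \<theta>u23 \<le> 0.0811727"
proof -
  have "0.0811724\<^sup>2 \<le> (sin \<theta>u23)\<^sup>2" "(sin \<theta>u23)\<^sup>2 \<le> 0.0811727\<^sup>2"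
    unfolding sin_squared_eq cos_squared_\<theta>u23
    using \<delta>_interval by (simp_all add: field_simps power2_eq_square)
  then show "0.0811724 \<le> sin \<theta>u23" "sin \<theta>u23 \<le> 0.0811727"
    using square_bounds[of "sin \<theta>u23" "0.0811727" "0.0811724"] sin_cos_positive by simp_all
qed

lemma cos_\<theta>u12_interval: "0.9991001 \<le> cos \<theta>u12" "cos \<theta>u12 \<le> 0.9991004"
proof -
  have "0.9991001\<^sup>2 \<le> (cos \<theta>u12)\<^sup>2" "(cos \<theta>u12)\<^sup>2 \<le> 0.9991004\<^sup>2"
    unfolding cos_squared_\<theta>u12 using \<delta>_interval by (simp_all add: field_simps power2_eq_square)
  then show "0.9991001 \<le> cos \<theta>u12" "cos \<theta>u12 \<le> 0.9991004"
    using square_bounds[of "cos \<theta>u12" "0.9991004" "0.9991001"] sin_cos_positive by simp_all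
qed

lemma sin_\<theta>u12_interval: "0.0424109 \<le> sin \<theta>u12" "sin \<theta>u12 \<le> 0.0424112"
proof -
  have "0.0424109\<^sup>2 \<le> (sin \<theta>u12)\<^sup>2" "(sin \<theta>u12)\<^sup>2 \<le> 0.0424112\<^sup>2"
    unfolding sin_squared_\<theta>u12 using \<delta>_interval by (simp_all add: field_simps power2_eq_square)
  then show "0.0424109 \<le> sin \<theta>u12" "sin \<theta>u12 \<le> 0.0424112"
    using square_bounds[of "sin \<theta>u12" "0.0424112" "0.0424109"] sin_cos_positive by simp_all
qed

lemma D_terms_interval:
  "0.1227937 \<le> sin \<theta>d23 * cos \<theta>u23" "sin \<theta>d23 * cos \<theta>u23 \<le> 0.1227941"
  "0.0805540 \<le> cos \<theta>d23 * sin \<theta>u23" "cos \<theta>d23 * sin \<theta>u23 \<le> 0.0805544"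
  using mult_bounds[OF sin_\<theta>d23_interval cos_\<theta>u23_interval]
    mult_bounds[OF cos_\<theta>d23_interval sin_\<theta>u23_interval] by simp_all

section \<open>The modulus of \<open>D\<close>\<close>

lemma cmod_diff_cis_squared:
  "(cmod (of_real a - cis \<psi> * of_real b))\<^sup>2 = (a - b)\<^sup>2 + 2 * (a * b) * (1 - cos \<psi>)"
proof -
  have "(cmod (of_real a - cis \<psi> * of_real b))\<^sup>2 = (a - cos \<psi> * b)\<^sup>2 + (sin \<psi> * b)\<^sup>2"
    by (simp add: cmod_power2)
  also have "\<dots> = a\<^sup>2 - 2 * (a * b) * cos \<psi> + b\<^sup>2 * ((sin \<psi>)\<^sup>2 + (cos \<psi>)\<^sup>2)"
    unfolding power2_eq_square by algebra
  finally show ?thesis by (simp add: algebra_simps power2_eq_square)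
qed

lemma cmod_D_squared:
  "(cmod (D \<psi>))\<^sup>2 = (sin \<theta>d23 * cos \<theta>u23 - cos \<theta>d23 * sin \<theta>u23)\<^sup>2
     + 2 * (sin \<theta>d23 * cos \<theta>u23 * (cos \<theta>d23 * sin \<theta>u23)) * (1 - cos \<psi>)"
  by (simp only: D_def cmod_diff_cis_squared)

lemma D_terms_product_pos: "0 < sin \<theta>d23 * cos \<theta>u23 * (cos \<theta>d23 * sin \<theta>u23)"
  by (intro mult_pos_pos sin_cos_positive)

text \<open>The coefficient of 1 - cos \<psi> in the squared modulus is positive. Monotonicity on
  [0, \<pi>], the minimum at \<psi> = 0 and the fact that \<open>D\<close> never vanishes all rest
  on this equivalence.\<close>

lemma cmod_D_le_iff: "cmod (D \<psi>) \<le> cmod (D \<omega>) \<longleftrightarrow> cos \<omega> \<le> cos \<psi>"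
proof -
  have "cmod (D \<psi>) \<le> cmod (D \<omega>) \<longleftrightarrow> (cmod (D \<psi>))\<^sup>2 \<le> (cmod (D \<omega>))\<^sup>2"
    by (meson norm_ge_zero power2_le_imp_le power_mono)
  also have "\<dots> \<longleftrightarrow> 1 - cos \<psi> \<le> 1 - cos \<omega>"
    unfolding cmod_D_squared add_le_cancel_left
    by (intro mult_le_cancel_left_pos mult_pos_pos D_terms_product_pos) simp
  finally show ?thesis by simp
qed

lemma cmod_D_interval:
  assumes "k \<le> 1 - cos \<psi>" "1 - cos \<psi> \<le> m" "0 \<le> k" "0 \<le> l" "0 \<le> u"
    and "l\<^sup>2 \<le> 0.0422393\<^sup>2 + 2 * (0.1227937 * 0.0805540) * k"
    and "0.0422401\<^sup>2 + 2 * (0.1227941 * 0.0805544) * m \<le> u\<^sup>2"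
  shows "l \<le> cmod (D \<psi>)" "cmod (D \<psi>) \<le> u"
proof -
  let ?A = "sin \<theta>d23 * cos \<theta>u23" and ?B = "cos \<theta>d23 * sin \<theta>u23"
  \<comment> \<open>Opposite endpoints of \<open>D_terms_interval\<close> are subtracted: 0.1227937
    - 0.0805544 and 0.1227941 - 0.0805540.\<close>
  have diff: "0.0422393\<^sup>2 \<le> (?A - ?B)\<^sup>2" "(?A - ?B)\<^sup>2 \<le> 0.0422401\<^sup>2"
    using D_terms_interval by (intro power_mono; simp)+
  have "0.1227937 * 0.0805540 \<le> ?A * ?B" "?A * ?B \<le> 0.1227941 * 0.0805544"
    by (intro mult_bounds[OF D_terms_interval]; simp)+
  then have prod: "0.1227937 * 0.0805540 * k \<le> ?A * ?B * (1 - cos \<psi>)"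
      "?A * ?B * (1 - cos \<psi>) \<le> 0.1227941 * 0.0805544 * m"
    using assms(1-3) mult_bounds[of "0.1227937 * 0.0805540" "?A * ?B" "0.1227941 * 0.0805544"
        k "1 - cos \<psi>" m] by simp_all
  have "l\<^sup>2 \<le> (cmod (D \<psi>))\<^sup>2" "(cmod (D \<psi>))\<^sup>2 \<le> u\<^sup>2"
    using assms(6,7) diff prod unfolding cmod_D_squared by linarith+
  then show "l \<le> cmod (D \<psi>)" "cmod (D \<psi>) \<le> u"
    using square_bounds[of "cmod (D \<psi>)" u l] \<open>0 \<le> u\<close> by simp_all
qed

lemma cmod_D_0_interval: "0.04223 \<le> cmod (D 0)" "cmod (D 0) \<le> 0.04225"
  using cmod_D_interval[of 0 0 0 "0.04223" "0.04225"] by (simp_all add: power2_eq_square)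

lemma cmod_D_30_interval: "0.06658 \<le> cmod (D (pi/6))" "cmod (D (pi/6)) \<le> 0.06660"
proof -
  have "1.73205 \<le> sqrt 3" "sqrt 3 \<le> 1.73206"
    by (rule real_le_rsqrt real_le_lsqrt; simp add: power2_eq_square)+
  then show "0.06658 \<le> cmod (D (pi/6))" "cmod (D (pi/6)) \<le> 0.06660"
    \<comment> \<open>The bounds on 1 - cos \<psi> are 1 - 1.73206/2 and 1 - 1.73205/2; at 45
      degrees the bounds on \<open>sqrt 2\<close> are used in the same way.\<close>
    using cmod_D_interval[of "0.13397" "pi/6" "0.133975" "0.06658" "0.06660"]
    by (simp_all add: cos_30 power2_eq_square)
qed

lemma cmod_D_45_interval: "0.08704 \<le> cmod (D (pi/4))" "cmod (D (pi/4)) \<le> 0.08707"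
proof -
  have "1.41421 \<le> sqrt 2" "sqrt 2 \<le> 1.41422"
    by (rule real_le_rsqrt real_le_lsqrt; simp add: power2_eq_square)+
  then show "0.08704 \<le> cmod (D (pi/4))" "cmod (D (pi/4)) \<le> 0.08707"
    using cmod_D_interval[of "0.29289" "pi/4" "0.292895" "0.08704" "0.08707"]
    by (simp_all add: cos_45 power2_eq_square)
qed

lemma cmod_D_90_interval: "0.14685 \<le> cmod (D (pi/2))" "cmod (D (pi/2)) \<le> 0.14687"
  using cmod_D_interval[of 1 "pi/2" 1 "0.14685" "0.14687"] by (simp_all add: power2_eq_square)

section \<open>Matrix entries and their common factor\<close>

lemma V_ub_eq: "V_ub \<psi> \<phi> = - of_real (sin \<theta>u12) * cis (-\<phi>) * D \<psi>"
  \<comment> \<open>\<open>rot12\<close> fixes the third basis vector, so the b column of the down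
    frame is (0, sin \<open>\<theta>d23\<close>, cos \<open>\<theta>d23\<close>), free of
    \<open>\<theta>d12\<close>. The u and c columns of the up frame meet it through the same (2,3)
    combination, scaled by the conjugated second-row entries of the up \<open>rot12\<close>; hence
    the shared factor \<open>D\<close>.\<close>
  by (simp add: V_ub_def D_def ckm_def ckm_phases_def hermitian_conj_def left_frame_def rot12_def
      rot23_def matrix_matrix_mult_def sum_3 cis_cnj algebra_simps)

lemma V_cb_eq: "V_cb \<psi> \<phi> = of_real (cos \<theta>u12) * D \<psi>"
  by (simp add: V_cb_def D_def ckm_def ckm_phases_def hermitian_conj_def left_frame_def rot12_def
      rot23_def matrix_matrix_mult_def sum_3 cis_cnj algebra_simps)

lemma cmod_V_ub: "cmod (V_ub \<psi> \<phi>) = sin \<theta>u12 * cmod (D \<psi>)"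
  using sin_cos_positive by (simp add: V_ub_eq norm_mult)

lemma cmod_V_cb: "cmod (V_cb \<psi> \<phi>) = cos \<theta>u12 * cmod (D \<psi>)"
  using sin_cos_positive by (simp add: V_cb_eq norm_mult)

lemma cmod_D_pos: "0 < cmod (D \<psi>)"
proof -
  have "cmod (D 0) \<le> cmod (D \<psi>)" by (simp add: cmod_D_le_iff)
  moreover have "0 < cmod (D 0)" using cmod_D_0_interval(1) by (rule less_le_trans[rotated]) simp
  ultimately show ?thesis by linarith
qed

lemma strict_mono_on_cmod_D: "strict_mono_on {0..pi} (\<lambda>\<psi>. cmod (D \<psi>))"
proof (rule strict_mono_onI)
  fix r s :: real assume "r \<in> {0..pi}" "s \<in> {0..pi}" "r < s"
  then have "cos s < cos r" by (intro cos_monotone_0_pi) auto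
  then show "cmod (D r) < cmod (D s)"
    using cmod_D_le_iff[of s r] by linarith
qed

section \<open>The table and the comparison with measurement\<close>

lemma V_entries_rounded:
  "rounds4 (cmod (V_cb 0 \<phi>)) 0.0422 \<and> rounds4 (cmod (V_cb (pi/6) \<phi>)) 0.0665 \<and>
   rounds4 (cmod (V_cb (pi/4) \<phi>)) 0.0870 \<and> rounds4 (cmod (V_cb (pi/2) \<phi>)) 0.1467 \<and>
   rounds4 (cmod (V_ub 0 \<phi>)) 0.0018 \<and> rounds4 (cmod (V_ub (pi/6) \<phi>)) 0.0028 \<and>
   rounds4 (cmod (V_ub (pi/4) \<phi>)) 0.0037 \<and> rounds4 (cmod (V_ub (pi/2) \<phi>)) 0.0062"
  \<comment> \<open>The tightest entry is \<open>V_cb\<close> at 30 degrees, where 0.9991004 *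
    0.06660 must stay below 0.06655.\<close>
  unfolding rounds4_def cmod_V_cb cmod_V_ub abs_diff_less_iff
  using mult_bounds[OF cos_\<theta>u12_interval cmod_D_0_interval]
    mult_bounds[OF cos_\<theta>u12_interval cmod_D_30_interval]
    mult_bounds[OF cos_\<theta>u12_interval cmod_D_45_interval]
    mult_bounds[OF cos_\<theta>u12_interval cmod_D_90_interval]
    mult_bounds[OF sin_\<theta>u12_interval cmod_D_0_interval]
    mult_bounds[OF sin_\<theta>u12_interval cmod_D_30_interval]
    mult_bounds[OF sin_\<theta>u12_interval cmod_D_45_interval]
    mult_bounds[OF sin_\<theta>u12_interval cmod_D_90_interval]
  by simp

lemma V_0_versus_measured: "cmod (V_ub 0 \<phi>) < V_ub_meas" "V_cb_meas < cmod (V_cb 0 \<phi>)"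
  \<comment> \<open>The rounded values suffice: 0.00185 < 0.003762 and 0.04188 < 0.04215.\<close>
  using V_entries_rounded[of \<phi>]
  unfolding rounds4_def abs_diff_less_iff V_ub_meas_def V_cb_meas_def by simp_all

lemma cmod_V_ratio: "cmod (V_ub \<psi> \<phi> / V_cb \<psi> \<phi>) = tan \<theta>u12"
  using cmod_D_pos[of \<psi>] by (simp add: norm_divide cmod_V_ub cmod_V_cb tan_def)

lemma V_common_inflation:
  "cmod (V_ub \<psi> \<phi>) / cmod (V_ub 0 \<phi>) = cmod (V_cb \<psi> \<phi>) / cmod (V_cb 0 \<phi>)"
  using sin_cos_positive by (simp add: cmod_V_ub cmod_V_cb)

lemma V_ub_measured_imp:
  assumes "cmod (V_ub \<psi> \<phi>) = V_ub_meas"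
  shows "cmod (V_cb \<psi> \<phi>) = V_ub_meas / cmod (V_ub 0 \<phi>) * cmod (V_cb 0 \<phi>)"
    and "cmod (V_cb 0 \<phi>) < cmod (V_cb \<psi> \<phi>)"
proof -
  show "cmod (V_cb \<psi> \<phi>) = V_ub_meas / cmod (V_ub 0 \<phi>) * cmod (V_cb 0 \<phi>)"
    using sin_cos_positive cmod_D_pos[of 0]
    by (simp add: cmod_V_ub cmod_V_cb flip: assms)
  \<comment> \<open>Both entries are fixed positive multiples of the modulus of \<open>D\<close>, so
    an increase of one forces an increase of the other.\<close>
  have "sin \<theta>u12 * cmod (D 0) < sin \<theta>u12 * cmod (D \<psi>)"
    using V_0_versus_measured(1)[of \<phi>] assms by (simp add: cmod_V_ub)
  then show "cmod (V_cb 0 \<phi>) < cmod (V_cb \<psi> \<phi>)"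
    using sin_cos_positive by (simp add: cmod_V_cb)
qed

text \<open>The modulus of \<open>D\<close> is least only where cos \<psi> = 1, so avoiding
  inflation forces \<psi> = 0 modulo 2 \<pi>, which \<open>cis \<psi> = 1\<close> expresses; there
  the \<open>V_ub\<close> deficit persists.\<close>

lemma V_cb_not_inflated_imp:
  assumes "cmod (V_cb \<psi> \<phi>) \<le> cmod (V_cb 0 \<phi>)"
  shows "cis \<psi> = 1" "cmod (V_ub \<psi> \<phi>) < V_ub_meas"
proof -
  have "cmod (D \<psi>) \<le> cmod (D 0)"
    using assms sin_cos_positive by (simp add: cmod_V_cb)
  then have "cos \<psi> = 1" using cmod_D_le_iff[of \<psi> 0] cos_le_one[of \<psi>] by simp
  then show "cis \<psi> = 1" using sin_cos_squared_add[of \<psi>] by (simp add: complex_eq_iff)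
  show "cmod (V_ub \<psi> \<phi>) < V_ub_meas"
    using V_0_versus_measured(1)[of \<phi>] \<open>cmod (D \<psi>) \<le> cmod (D 0)\<close> sin_cos_positive(1)
    by (simp add: cmod_V_ub order_le_less_trans[OF mult_left_mono])
qed

text \<open>This renders "destructive and real": two positive terms, separated by their enclosures,
  are subtracted with no relative phase.\<close>

lemma D_0_destructive_real:
  "0 < cos \<theta>d23 * sin \<theta>u23 \<and> cos \<theta>d23 * sin \<theta>u23 < sin \<theta>d23 * cos \<theta>u23 \<and>
   D 0 = of_real (sin \<theta>d23 * cos \<theta>u23 - cos \<theta>d23 * sin \<theta>u23)"
  using D_terms_interval by (simp add: D_def)

theorem lemma1:
  shows
    "(\<forall>\<phi>. rounds4 (cmod (V_cb 0 \<phi>)) 0.0422 \<and> rounds4 (cmod (V_cb (pi/6) \<phi>)) 0.0665 \<and>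
          rounds4 (cmod (V_cb (pi/4) \<phi>)) 0.0870 \<and> rounds4 (cmod (V_cb (pi/2) \<phi>)) 0.1467 \<and>
          rounds4 (cmod (V_ub 0 \<phi>)) 0.0018 \<and> rounds4 (cmod (V_ub (pi/6) \<phi>)) 0.0028 \<and>
          rounds4 (cmod (V_ub (pi/4) \<phi>)) 0.0037 \<and> rounds4 (cmod (V_ub (pi/2) \<phi>)) 0.0062)
     \<and> (\<forall>\<psi> \<phi>. V_ub \<psi> \<phi> = - of_real (sin \<theta>u12) * cis (-\<phi>) * D \<psi> \<and>
              V_cb \<psi> \<phi> = of_real (cos \<theta>u12) * D \<psi>)
     \<and> (\<forall>\<psi> \<phi>. cmod (V_ub \<psi> \<phi> / V_cb \<psi> \<phi>) = tan \<theta>u12)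
     \<and> strict_mono_on {0..pi} (\<lambda>\<psi>. cmod (D \<psi>))
     \<and> (\<forall>\<psi> \<phi>. cmod (V_ub \<psi> \<phi>) / cmod (V_ub 0 \<phi>) = cmod (V_cb \<psi> \<phi>) / cmod (V_cb 0 \<phi>))
     \<and> (\<forall>\<phi>. cmod (V_ub 0 \<phi>) < V_ub_meas \<and> V_cb_meas < cmod (V_cb 0 \<phi>))
     \<and> (\<forall>\<psi> \<phi>. cmod (V_ub \<psi> \<phi>) = V_ub_meas \<longrightarrow>
              cmod (V_cb \<psi> \<phi>) = V_ub_meas / cmod (V_ub 0 \<phi>) * cmod (V_cb 0 \<phi>) \<and>
              cmod (V_cb 0 \<phi>) < cmod (V_cb \<psi> \<phi>))
     \<and> (0 < cos \<theta>d23 * sin \<theta>u23 \<and> cos \<theta>d23 * sin \<theta>u23 < sin \<theta>d23 * cos \<theta>u23 \<and>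
        D 0 = of_real (sin \<theta>d23 * cos \<theta>u23 - cos \<theta>d23 * sin \<theta>u23))
     \<and> (\<forall>\<psi> \<phi>. cmod (V_cb \<psi> \<phi>) \<le> cmod (V_cb 0 \<phi>) \<longrightarrow>
              cis \<psi> = 1 \<and> cmod (V_ub \<psi> \<phi>) < V_ub_meas)"
  using V_entries_rounded V_ub_eq V_cb_eq cmod_V_ratio strict_mono_on_cmod_D V_common_inflation
    V_0_versus_measured V_ub_measured_imp V_cb_not_inflated_imp D_0_destructive_real
  by (intro conjI allI impI) blast+

end
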